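(* Let $(X,S)$ be a coherent configuration. For $a,b,c\in S$ put $$\dot\nabla_{ab}^c=\sqrt{\frac{\|c\|}{\|a\|\,\|b\|}}\;\nabla_{ab}^c,$$ so that $\dot\nabla\colon S\otimes S\to S$ is a morphism in $\mathbf{Mat}_{\mathbb R_0^+}$, and let $e\colon I\to S$ be given by $e_*^a=1$ if $a\subseteq\mathrm{id}_X$ and $0$ otherwise. Then $(S,\dot\nabla,e)$ is a dagger Frobenius structure in $\mathbf{Mat}_{\mathbb R_0^+}$.
   Context: $\mathbf{Mat}_{\mathbb R_0^+}$ is the category whose objects are finite sets and whose morphisms $f\colon X\to Y$ are matrices $(f_x^y)_{x\in X,y\in Y}$ of non-negative reals, with composition $(g\circ f)_a^c=\sum_{b}f_a^b g_b^c$. It is symmetric monoidal with $X\otimes Y=X\times Y$, $(f\otimes g)_{ac}^{bd}=f_a^b g_c^d$, unit object $I=\{*\}$, and structural isomorphisms transferred from finite sets; $f^\dagger$ is the transpose of $f$. A coherent configuration $(X,S)$ is a finite set $X$ with a partition $S$ of $X\times X$ such that: if $p\in S$ contains some $(x,x)$ then $p\subseteq\mathrm{id}_X$; for $a,b,c\in S$ the number $\nabla_{ab}^c$ of $z\in X$ with $(x,z)\in a$, $(z,y)\in b$ is the same for all $(x,y)\in c$; and $c\in S$ implies $c^{-1}=\{(y,x):(x,y)\in c\}\in S$. The valency $\|a\|$ of $a\in S$ is the number of $y\in X$ with $(x,y)\in a$, for any $x$ for which at least one such $y$ exists (it is independent of $x$). A dagger Frobenius structure in $\mathbf{Mat}_{\mathbb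 R_0^+}$ is a triple $(S,\mu,e)$ with $\mu\colon S\otimes S\to S$, $e\colon I\to S$ such that $(S,\mu,e)$ is a monoid (so that $(S,\mu^\dagger,e^\dagger)$ is a comonoid) and the Frobenius law holds: $(\mu\otimes\mathrm{id}_S)\circ(\mathrm{id}_S\otimes\mu^\dagger)=\mu^\dagger\circ\mu=(\mathrm{id}_S\otimes\mu)\circ(\mu^\dagger\otimes\mathrm{id}_S)$. *)

theory Defs
  imports Complex_Main "HOL-Library.Disjoint_Sets"
begin

section \<open>The category of non-negative real matrices\<close>

text \<open>
  The objects are finite sets (of any type).  A morphism from \<open>X\<close> to \<open>Y\<close> is a function
  \<open>f\<close>, with \<open>f x y\<close> in the role of the entry with lower index \<open>x\<close> and upper index \<open>y\<close>,
  that vanishes outside \<open>X \<times> Y\<close>; hence two morphisms with the same source and target are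
  equal precisely when they are equal as HOL functions.  The tensor product of objects is \<open>\<times>\<close>
  and the unit object is \<open>{()}\<close>.
\<close>

type_synonym ('a, 'b) mat = "'a \<Rightarrow> 'b \<Rightarrow> real"

definition mat_hom :: "'a set \<Rightarrow> 'b set \<Rightarrow> ('a, 'b) mat set" where
  "mat_hom X Y = {f. (\<forall>x\<in>X. \<forall>y\<in>Y. 0 \<le> f x y) \<and> (\<forall>x y. x \<notin> X \<or> y \<notin> Y \<longrightarrow> f x y = 0)}"

definition mat_on :: "'a set \<Rightarrow> 'b set \<Rightarrow> ('a \<Rightarrow> 'b \<Rightarrow> real) \<Rightarrow> ('a, 'b) mat" where
  "mat_on X Y f = (\<lambda>x y. if x \<in> X \<and> y \<in> Y then f x y else 0)"

text \<open>\<open>mat_comp Y g f\<close> is the composite of \<open>f\<close> followed by \<open>g\<close> through the middle object \<open>Y\<close>.\<close>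

definition mat_comp :: "'b set \<Rightarrow> ('b, 'c) mat \<Rightarrow> ('a, 'b) mat \<Rightarrow> ('a, 'c) mat" where
  "mat_comp Y g f = (\<lambda>a c. \<Sum>b\<in>Y. f a b * g b c)"

definition mat_tensor :: "('a, 'b) mat \<Rightarrow> ('c, 'd) mat \<Rightarrow> ('a \<times> 'c, 'b \<times> 'd) mat" where
  "mat_tensor f g = (\<lambda>(a, c) (b, d). f a b * g c d)"

definition mat_dagger :: "('a, 'b) mat \<Rightarrow> ('b, 'a) mat" where
  "mat_dagger f = (\<lambda>y x. f x y)"

text \<open>The matrix of a map \<open>\<phi>\<close> of finite sets from \<open>X\<close> to \<open>Y\<close>; the identities and the structural
  isomorphisms are of this form.\<close>

definition mat_of_fun :: "'a set \<Rightarrow> 'b set \<Rightarrow> ('a \<Rightarrow> 'b) \<Rightarrow> ('a, 'b) mat" where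
  "mat_of_fun X Y \<phi> = mat_on X Y (\<lambda>x y. if y = \<phi> x then 1 else 0)"

definition mat_id :: "'a set \<Rightarrow> ('a, 'a) mat" where
  "mat_id X = mat_of_fun X X (\<lambda>x. x)"

definition mat_assoc :: "'a set \<Rightarrow> 'b set \<Rightarrow> 'c set \<Rightarrow> (('a \<times> 'b) \<times> 'c, 'a \<times> ('b \<times> 'c)) mat" where
  "mat_assoc X Y Z = mat_of_fun ((X \<times> Y) \<times> Z) (X \<times> (Y \<times> Z)) (\<lambda>((x, y), z). (x, (y, z)))"

definition mat_assoc_inv :: "'a set \<Rightarrow> 'b set \<Rightarrow> 'c set \<Rightarrow> ('a \<times> ('b \<times> 'c), ('a \<times> 'b) \<times> 'c) mat" where
  "mat_assoc_inv X Y Z = mat_of_fun (X \<times> (Y \<times> Z)) ((X \<times> Y) \<times> Z) (\<lambda>(x, (y, z)). ((x, y), z))"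

definition mat_lunit :: "'a set \<Rightarrow> (unit \<times> 'a, 'a) mat" where
  "mat_lunit X = mat_of_fun ({()} \<times> X) X snd"

definition mat_runit :: "'a set \<Rightarrow> ('a \<times> unit, 'a) mat" where
  "mat_runit X = mat_of_fun (X \<times> {()}) X fst"

definition mat_monoid :: "'a set \<Rightarrow> ('a \<times> 'a, 'a) mat \<Rightarrow> (unit, 'a) mat \<Rightarrow> bool" where
  "mat_monoid A \<mu> e \<longleftrightarrow>
     finite A \<and> \<mu> \<in> mat_hom (A \<times> A) A \<and> e \<in> mat_hom {()} A \<and>
     mat_comp (A \<times> A) \<mu> (mat_tensor \<mu> (mat_id A)) =
       mat_comp (A \<times> A) \<mu>
         (mat_comp (A \<times> (A \<times> A)) (mat_tensor (mat_id A) \<mu>) (mat_assoc A A A)) \<and>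
     mat_comp (A \<times> A) \<mu> (mat_tensor e (mat_id A)) = mat_lunit A \<and>
     mat_comp (A \<times> A) \<mu> (mat_tensor (mat_id A) e) = mat_runit A"

text \<open>In the Frobenius law the associators between the two factors of each outer composite, usually
  suppressed, are written out.\<close>

definition dagger_frobenius :: "'a set \<Rightarrow> ('a \<times> 'a, 'a) mat \<Rightarrow> (unit, 'a) mat \<Rightarrow> bool" where
  "dagger_frobenius A \<mu> e \<longleftrightarrow>
     mat_monoid A \<mu> e \<and>
     mat_comp ((A \<times> A) \<times> A) (mat_tensor \<mu> (mat_id A))
       (mat_comp (A \<times> (A \<times> A)) (mat_assoc_inv A A A) (mat_tensor (mat_id A) (mat_dagger \<mu>)))
     = mat_comp A (mat_dagger \<mu>) \<mu> \<and>
     mat_comp A (mat_dagger \<mu>) \<mu>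
     = mat_comp (A \<times> (A \<times> A)) (mat_tensor (mat_id A) \<mu>)
       (mat_comp ((A \<times> A) \<times> A) (mat_assoc A A A) (mat_tensor (mat_dagger \<mu>) (mat_id A)))"


section \<open>Coherent configurations\<close>

definition coherent_configuration :: "'a set \<Rightarrow> ('a \<times> 'a) set set \<Rightarrow> bool" where
  "coherent_configuration X S \<longleftrightarrow>
     finite X \<and> partition_on (X \<times> X) S \<and>
     (\<forall>p\<in>S. (\<exists>x. (x, x) \<in> p) \<longrightarrow> p \<subseteq> Id_on X) \<and>
     (\<forall>a\<in>S. \<forall>b\<in>S. \<forall>c\<in>S. \<exists>n. \<forall>(x, y)\<in>c. card {z \<in> X. (x, z) \<in> a \<and> (z, y) \<in> b} = n) \<and>
     (\<forall>c\<in>S. c\<inverse> \<in> S)"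

definition intersection_number ::
    "'a set \<Rightarrow> ('a \<times> 'a) set \<Rightarrow> ('a \<times> 'a) set \<Rightarrow> ('a \<times> 'a) set \<Rightarrow> nat" where
  "intersection_number X a b c =
     (THE n. \<forall>(x, y)\<in>c. card {z \<in> X. (x, z) \<in> a \<and> (z, y) \<in> b} = n)"

definition valency :: "'a set \<Rightarrow> ('a \<times> 'a) set \<Rightarrow> nat" where
  "valency X a = (THE n. \<forall>x\<in>X. (\<exists>y\<in>X. (x, y) \<in> a) \<longrightarrow> card {y \<in> X. (x, y) \<in> a} = n)"

text \<open>The two descriptions above do determine the numbers they name.\<close>

lemma intersection_number_eq:
  assumes "coherent_configuration X S" "a \<in> S" "b \<in> S" "c \<in> S" "(x, y) \<in> c"
  shows "intersection_number X a b c = card {z \<in> X. (x, z) \<in> a \<and> (z, y) \<in> b}"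
proof -
  obtain n where n: "\<forall>(x, y)\<in>c. card {z \<in> X. (x, z) \<in> a \<and> (z, y) \<in> b} = n"
    using assms unfolding coherent_configuration_def by meson
  have "intersection_number X a b c = n"
    unfolding intersection_number_def using n assms(5) by (intro the_equality) auto
  with n assms(5) show ?thesis by auto
qed

lemma valency_eq:
  assumes cc: "coherent_configuration X S" and a: "a \<in> S" and xy: "(x, y) \<in> a"
  shows "valency X a = card {y \<in> X. (x, y) \<in> a}"
proof -
  have part: "partition_on (X \<times> X) S" using cc by (simp add: coherent_configuration_def)
  have aX: "a \<subseteq> X \<times> X" using part a by (auto simp: partition_on_def)
  have ai: "a\<inverse> \<in> S" using cc a by (simp add: coherent_configuration_def)
  have same: "card {y \<in> X. (x', y) \<in> a} = card {y \<in> X. (x, y) \<in> a}" if x': "(x', y') \<in> a" for x' y'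
  proof -
    have "(x, x) \<in> X \<times> X" using xy aX by auto
    then obtain p where p: "p \<in> S" "(x, x) \<in> p" using part by (auto simp: partition_on_def)
    have pId: "p \<subseteq> Id_on X" using cc p unfolding coherent_configuration_def by blast
    have "{z \<in> X. (x, z) \<in> p \<and> (z, y) \<in> a} = {x}" using pId p xy aX by auto
    then have "card {z \<in> X. (x', z) \<in> p \<and> (z, y') \<in> a} = 1"
      using intersection_number_eq[OF cc p(1) a a xy] intersection_number_eq[OF cc p(1) a a x']
      by simp
    then have "{z \<in> X. (x', z) \<in> p \<and> (z, y') \<in> a} \<noteq> {}" by force
    then have x'p: "(x', x') \<in> p" using pId by auto
    show ?thesis
      using intersection_number_eq[OF cc a ai p(1) p(2)] intersection_number_eq[OF cc a ai p(1) x'p]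
      by simp
  qed
  show ?thesis
    unfolding valency_def
  proof (rule the_equality)
    show "\<forall>x'\<in>X. (\<exists>y\<in>X. (x', y) \<in> a) \<longrightarrow> card {y \<in> X. (x', y) \<in> a} = card {y \<in> X. (x, y) \<in> a}"
      using same by blast
    show "n = card {y \<in> X. (x, y) \<in> a}"
      if "\<forall>x\<in>X. (\<exists>y\<in>X. (x, y) \<in> a) \<longrightarrow> card {y \<in> X. (x, y) \<in> a} = n" for n
      using that xy aX by blast
  qed
qed

definition normalized_mult ::
    "'a set \<Rightarrow> ('a \<times> 'a) set set \<Rightarrow> (('a \<times> 'a) set \<times> ('a \<times> 'a) set, ('a \<times> 'a) set) mat" where
  "normalized_mult X S = mat_on (S \<times> S) S
     (\<lambda>(a, b) c. sqrt (real (valency X c) / (real (valency X a) * real (valency X b)))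
                  * real (intersection_number X a b c))"

definition identity_unit ::
    "'a set \<Rightarrow> ('a \<times> 'a) set set \<Rightarrow> (unit, ('a \<times> 'a) set) mat" where
  "identity_unit X S = mat_on {()} S (\<lambda>_ a. if a \<subseteq> Id_on X then 1 else 0)"

end

theory Submission
  imports Defs
begin

text \<open>
  Counting chains \<open>x, z, w, y\<close> of three steps through the classes \<open>a, b, c\<close> in two ways makes the
  intersection numbers associative, and in \<open>\<nabla>\<^sub>a\<^sub>b\<^sup>x \<nabla>\<^sub>x\<^sub>c\<^sup>d\<close> the normalizing factors of the middle class
  cancel.  Counting triangles with one vertex fixed gives
  \<open>\<parallel>c\<parallel> \<nabla>\<^sub>a\<^sub>b\<^sup>c = \<parallel>a\<parallel> \<nabla>\<^sub>c\<^sub>b\<^sub>*\<^sup>a\<close>, where \<open>b\<^sub>*\<close> is the converse of \<open>b\<close>.  After normalization an index can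
  thus be moved between source and target at the cost of the factor \<open>sqrt (\<parallel>b\<^sub>*\<parallel> / \<parallel>b\<parallel>)\<close>, which need
  not be \<open>1\<close> if the configuration is not homogeneous.  The Frobenius law follows from associativity
  by moving an index twice, once along \<open>b\<close> and once along \<open>b\<^sub>*\<close>; the two factors cancel.
\<close>

section \<open>Entries of composites and tensor products of matrices\<close>

lemma mat_id_apply: "mat_id A x y = (if x = y \<and> x \<in> A then 1 else 0)"
  by (auto simp: mat_id_def mat_of_fun_def mat_on_def)

lemma mat_tensor_apply: "mat_tensor f g (a, c) (b, d) = f a b * g c d"
  by (simp add: mat_tensor_def)

text \<open>Row \<open>x\<close> of the matrix of a map has a single entry 1, at
  \<open>\<phi> x\<close>, so precomposing with it only reindexes. Since \<open>\<phi> x\<close>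
  lies in \<open>Y\<close>, that entry does occur in the sum over the middle object.\<close>

lemma mat_comp_mat_of_fun:
  assumes "finite Y" "\<And>x. x \<in> X \<Longrightarrow> \<phi> x \<in> Y"
  shows "mat_comp Y g (mat_of_fun X Y \<phi>) x z = (if x \<in> X then g (\<phi> x) z else 0)"
proof (cases "x \<in> X")
  case True
  have "mat_comp Y g (mat_of_fun X Y \<phi>) x z = (\<Sum>y\<in>Y. if y = \<phi> x then g y z else 0)"
    unfolding mat_comp_def using True
    by (intro sum.cong) (auto simp: mat_of_fun_def mat_on_def)
  then show ?thesis
    using assms True by simp
qed (simp add: mat_comp_def mat_of_fun_def mat_on_def)

lemma mat_hom_zero:
  assumes "f \<in> mat_hom X Y" "x \<notin> X \<or> y \<notin> Y"
  shows "f x y = 0"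
  using assms by (auto simp: mat_hom_def)

lemma sum_delta_left:
  fixes f :: "'a \<Rightarrow> 'b \<Rightarrow> real"
  assumes "finite A" "finite B" "a \<in> A"
  shows "(\<Sum>(x, y)\<in>A \<times> B. if x = a then f x y else 0) = (\<Sum>y\<in>B. f a y)"
proof -
  have "(\<Sum>(x, y)\<in>A \<times> B. if x = a then f x y else 0) = (\<Sum>y\<in>B. \<Sum>x\<in>A. if x = a then f x y else 0)"
    by (subst sum.cartesian_product[symmetric]) (rule sum.swap)
  then show ?thesis using assms by simp
qed

lemma sum_delta_right:
  fixes f :: "'a \<Rightarrow> 'b \<Rightarrow> real"
  assumes "finite A" "finite B" "b \<in> B"
  shows "(\<Sum>(x, y)\<in>A \<times> B. if y = b then f x y else 0) = (\<Sum>x\<in>A. f x b)"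
  using assms by (subst sum.cartesian_product[symmetric]) simp

text \<open>The Kronecker delta of the identity factor collapses the double sum to the wire that
  carries \<open>f\<close>. For \<open>c\<close> outside \<open>A\<close> both sides vanish, the
  left one through \<open>mat_id\<close> and the right one through \<open>\<mu>\<close>, so the
  formula can be used at every index.\<close>

lemma mat_comp_tensor_id_right:
  assumes "finite A" "\<mu> \<in> mat_hom (A \<times> A) A"
  shows "mat_comp (A \<times> A) \<mu> (mat_tensor f (mat_id A)) (i, c) d = (\<Sum>x\<in>A. f i x * \<mu> (x, c) d)"
proof (cases "c \<in> A")
  case True
  have "mat_comp (A \<times> A) \<mu> (mat_tensor f (mat_id A)) (i, c) d
      = (\<Sum>(x, y)\<in>A \<times> A. if y = c then f i x * \<mu> (x, y) d else 0)"
    unfolding mat_comp_def using True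
    by (intro sum.cong) (auto simp: mat_tensor_apply mat_id_apply)
  then show ?thesis using sum_delta_right[OF assms(1,1) True, of "\<lambda>x y. f i x * \<mu> (x, y) d"] by simp
next
  case False
  then have "\<And>x. \<mu> (x, c) d = 0" by (intro mat_hom_zero[OF assms(2)]) auto
  then show ?thesis
    using False by (auto simp: mat_comp_def mat_tensor_apply mat_id_apply intro!: sum.neutral)
qed

lemma mat_comp_tensor_id_left:
  assumes "finite A" "\<mu> \<in> mat_hom (A \<times> A) A"
  shows "mat_comp (A \<times> A) \<mu> (mat_tensor (mat_id A) f) (a, i) d = (\<Sum>x\<in>A. f i x * \<mu> (a, x) d)"
proof (cases "a \<in> A")
  case True
  have "mat_comp (A \<times> A) \<mu> (mat_tensor (mat_id A) f) (a, i) d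
      = (\<Sum>(x, y)\<in>A \<times> A. if x = a then f i y * \<mu> (x, y) d else 0)"
    unfolding mat_comp_def using True
    by (intro sum.cong) (auto simp: mat_tensor_apply mat_id_apply)
  then show ?thesis using sum_delta_left[OF assms(1,1) True, of "\<lambda>x y. f i y * \<mu> (x, y) d"] by simp
next
  case False
  then have "\<And>x. \<mu> (a, x) d = 0" by (intro mat_hom_zero[OF assms(2)]) auto
  then show ?thesis
    using False by (auto simp: mat_comp_def mat_tensor_apply mat_id_apply intro!: sum.neutral)
qed

lemma card_Sigma_const:
  assumes "finite A" "\<And>x. x \<in> A \<Longrightarrow> finite (B x)" "\<And>x. x \<in> A \<Longrightarrow> card (B x) = k"
  shows "card (Sigma A B) = card A * k"
  using assms by simp

section \<open>Monoid and Frobenius laws as identities between matrix entries\<close>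

lemma mat_monoidI:
  assumes fin: "finite A" and hom: "\<mu> \<in> mat_hom (A \<times> A) A" and ehom: "e \<in> mat_hom {()} A"
    and assoc: "\<And>a b c d. a \<in> A \<Longrightarrow> b \<in> A \<Longrightarrow> c \<in> A \<Longrightarrow> d \<in> A \<Longrightarrow>
      (\<Sum>x\<in>A. \<mu> (a, b) x * \<mu> (x, c) d) = (\<Sum>x\<in>A. \<mu> (b, c) x * \<mu> (a, x) d)"
    and lunit: "\<And>a b. a \<in> A \<Longrightarrow> b \<in> A \<Longrightarrow> (\<Sum>x\<in>A. e () x * \<mu> (x, a) b) = (if a = b then 1 else 0)"
    and runit: "\<And>a b. a \<in> A \<Longrightarrow> b \<in> A \<Longrightarrow> (\<Sum>x\<in>A. e () x * \<mu> (a, x) b) = (if a = b then 1 else 0)"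
  shows "mat_monoid A \<mu> e"
proof -
  have zero: "\<mu> (x, y) z = 0" if "x \<notin> A \<or> y \<notin> A \<or> z \<notin> A" for x y z
    using mat_hom_zero[OF hom, of "(x, y)" z] that by auto
  have A3: "mat_comp (A \<times> A) \<mu> (mat_comp (A \<times> (A \<times> A)) (mat_tensor (mat_id A) \<mu>) (mat_assoc A A A))
      ((a, b), c) d = (\<Sum>x\<in>A. \<mu> (b, c) x * \<mu> (a, x) d)" for a b c d
  proof -
    have "mat_comp (A \<times> (A \<times> A)) (mat_tensor (mat_id A) \<mu>) (mat_assoc A A A) ((a, b), c)
        = mat_tensor (mat_id A) \<mu> (a, (b, c))"
      unfolding mat_assoc_def
      by (rule ext, subst mat_comp_mat_of_fun) (use fin zero in \<open>auto simp: mat_tensor_apply mat_id_apply\<close>)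
    then have "mat_comp (A \<times> A) \<mu> (mat_comp (A \<times> (A \<times> A)) (mat_tensor (mat_id A) \<mu>) (mat_assoc A A A))
        ((a, b), c) d = mat_comp (A \<times> A) \<mu> (mat_tensor (mat_id A) \<mu>) (a, (b, c)) d"
      by (simp only: mat_comp_def[of "A \<times> A" \<mu>])
    then show ?thesis using mat_comp_tensor_id_left[OF fin hom] by simp
  qed
  \<comment> \<open>Equality of matrices is equality of functions on the whole type, so the law is
    extended to indices outside \<open>A\<close>, where every summand on either side is
    zero.\<close>
  have assoc': "(\<Sum>x\<in>A. \<mu> (a, b) x * \<mu> (x, c) d) = (\<Sum>x\<in>A. \<mu> (b, c) x * \<mu> (a, x) d)" for a b c d
    by (cases "a \<in> A \<and> b \<in> A \<and> c \<in> A \<and> d \<in> A") (auto simp: assoc zero)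
  have "mat_comp (A \<times> A) \<mu> (mat_tensor \<mu> (mat_id A)) = mat_comp (A \<times> A) \<mu>
         (mat_comp (A \<times> (A \<times> A)) (mat_tensor (mat_id A) \<mu>) (mat_assoc A A A))"
    by (intro ext, clarify) (simp only: A3 mat_comp_tensor_id_right[OF fin hom] assoc'[symmetric])
  moreover have "mat_comp (A \<times> A) \<mu> (mat_tensor e (mat_id A)) = mat_lunit A"
  proof (intro ext)
    fix p b
    show "mat_comp (A \<times> A) \<mu> (mat_tensor e (mat_id A)) p b = mat_lunit A p b"
      by (cases p, cases "snd p \<in> A \<and> b \<in> A")
        (auto simp: mat_comp_tensor_id_right[OF fin hom] lunit zero
          mat_lunit_def mat_of_fun_def mat_on_def)
  qed
  moreover have "mat_comp (A \<times> A) \<mu> (mat_tensor (mat_id A) e) = mat_runit A"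
  proof (intro ext)
    fix p b
    show "mat_comp (A \<times> A) \<mu> (mat_tensor (mat_id A) e) p b = mat_runit A p b"
      by (cases p, cases "fst p \<in> A \<and> b \<in> A")
        (auto simp: mat_comp_tensor_id_left[OF fin hom] runit zero
          mat_runit_def mat_of_fun_def mat_on_def)
  qed
  ultimately show ?thesis
    using fin hom ehom by (simp add: mat_monoid_def)
qed

text \<open>Read as a string diagram: \<open>b\<close> is split into \<open>x\<close> and
  \<open>d\<close>, giving the daggered entry \<open>\<mu> (x, d) b\<close>, and then
  \<open>a\<close> and \<open>x\<close> are multiplied to \<open>c\<close>. The sum runs over the
  label \<open>x\<close> of the one inner wire.\<close>

lemma frobenius_left_apply:
  assumes fin: "finite A" and hom: "\<mu> \<in> mat_hom (A \<times> A) A"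
  shows "mat_comp ((A \<times> A) \<times> A) (mat_tensor \<mu> (mat_id A))
      (mat_comp (A \<times> (A \<times> A)) (mat_assoc_inv A A A) (mat_tensor (mat_id A) (mat_dagger \<mu>)))
      (a, b) (c, d) = (\<Sum>x\<in>A. \<mu> (x, d) b * \<mu> (a, x) c)"
proof -
  have zero: "\<mu> (x, y) z = 0" if "x \<notin> A \<or> y \<notin> A \<or> z \<notin> A" for x y z
    using mat_hom_zero[OF hom, of "(x, y)" z] that by auto
  \<comment> \<open>The inverse associator is the matrix of a bijection, so only the triple that
    rebrackets to \<open>((x, y), z)\<close> contributes.\<close>
  have inner: "mat_comp (A \<times> (A \<times> A)) (mat_assoc_inv A A A) (mat_tensor (mat_id A) (mat_dagger \<mu>))
      (a, b) ((x, y), z) = (if x = a \<and> a \<in> A then \<mu> (y, z) b else 0)" for x y z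
  proof (cases "x \<in> A \<and> y \<in> A \<and> z \<in> A")
    case True
    have "mat_comp (A \<times> (A \<times> A)) (mat_assoc_inv A A A) (mat_tensor (mat_id A) (mat_dagger \<mu>))
      (a, b) ((x, y), z)
      = (\<Sum>p\<in>A \<times> (A \<times> A). if p = (x, (y, z)) then (if x = a \<and> a \<in> A then \<mu> (y, z) b else 0) else 0)"
      unfolding mat_comp_def
      by (intro sum.cong)
        (auto simp: mat_assoc_inv_def mat_of_fun_def mat_on_def mat_tensor_apply mat_id_apply mat_dagger_def)
    then show ?thesis using fin True by simp
  next
    case False
    then show ?thesis
      by (auto simp: mat_comp_def mat_assoc_inv_def mat_of_fun_def mat_on_def zero)
  qed
  show ?thesis
  proof (cases "a \<in> A \<and> d \<in> A")
    case True
    have "mat_comp ((A \<times> A) \<times> A) (mat_tensor \<mu> (mat_id A))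
      (mat_comp (A \<times> (A \<times> A)) (mat_assoc_inv A A A) (mat_tensor (mat_id A) (mat_dagger \<mu>)))
      (a, b) (c, d)
      = (\<Sum>(p, z)\<in>(A \<times> A) \<times> A. if z = d then (case p of (x, y) \<Rightarrow>
           if x = a then \<mu> (y, z) b * \<mu> (x, y) c else 0) else 0)"
      unfolding mat_comp_def[where Y = "(A \<times> A) \<times> A"] using True
      by (intro sum.cong) (auto simp: inner mat_tensor_apply mat_id_apply)
    also have "\<dots> = (\<Sum>(x, y)\<in>A \<times> A. if x = a then \<mu> (y, d) b * \<mu> (x, y) c else 0)"
      using fin True by (subst sum_delta_right) auto
    also have "\<dots> = (\<Sum>y\<in>A. \<mu> (y, d) b * \<mu> (a, y) c)"
      using fin True by (subst sum_delta_left) auto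
    finally show ?thesis .
  next
    case False
    have "mat_comp ((A \<times> A) \<times> A) (mat_tensor \<mu> (mat_id A))
      (mat_comp (A \<times> (A \<times> A)) (mat_assoc_inv A A A) (mat_tensor (mat_id A) (mat_dagger \<mu>)))
      (a, b) (c, d) = 0"
      unfolding mat_comp_def[where Y = "(A \<times> A) \<times> A"] using False
      by (intro sum.neutral) (auto simp: inner mat_tensor_apply mat_id_apply)
    then show ?thesis using False by (auto simp: zero)
  qed
qed

text \<open>The mirror image of the previous diagram: \<open>a\<close> is split into
  \<open>c\<close> and \<open>x\<close>, and then \<open>x\<close> and \<open>b\<close> are
  multiplied to \<open>d\<close>.\<close>

lemma frobenius_right_apply:
  assumes fin: "finite A" and hom: "\<mu> \<in> mat_hom (A \<times> A) A"
  shows "mat_comp (A \<times> (A \<times> A)) (mat_tensor (mat_id A) \<mu>)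
      (mat_comp ((A \<times> A) \<times> A) (mat_assoc A A A) (mat_tensor (mat_dagger \<mu>) (mat_id A)))
      (a, b) (c, d) = (\<Sum>x\<in>A. \<mu> (c, x) a * \<mu> (x, b) d)"
proof -
  have zero: "\<mu> (x, y) z = 0" if "x \<notin> A \<or> y \<notin> A \<or> z \<notin> A" for x y z
    using mat_hom_zero[OF hom, of "(x, y)" z] that by auto
  have inner: "mat_comp ((A \<times> A) \<times> A) (mat_assoc A A A) (mat_tensor (mat_dagger \<mu>) (mat_id A))
      (a, b) (x, (y, z)) = (if z = b \<and> b \<in> A then \<mu> (x, y) a else 0)" for x y z
  proof (cases "x \<in> A \<and> y \<in> A \<and> z \<in> A")
    case True
    have "mat_comp ((A \<times> A) \<times> A) (mat_assoc A A A) (mat_tensor (mat_dagger \<mu>) (mat_id A))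
      (a, b) (x, (y, z))
      = (\<Sum>p\<in>(A \<times> A) \<times> A. if p = ((x, y), z) then (if z = b \<and> b \<in> A then \<mu> (x, y) a else 0) else 0)"
      unfolding mat_comp_def
      by (intro sum.cong)
        (auto simp: mat_assoc_def mat_of_fun_def mat_on_def mat_tensor_apply mat_id_apply mat_dagger_def)
    then show ?thesis using fin True by simp
  next
    case False
    then show ?thesis
      by (auto simp: mat_comp_def mat_assoc_def mat_of_fun_def mat_on_def zero)
  qed
  show ?thesis
  proof (cases "b \<in> A \<and> c \<in> A")
    case True
    have "mat_comp (A \<times> (A \<times> A)) (mat_tensor (mat_id A) \<mu>)
      (mat_comp ((A \<times> A) \<times> A) (mat_assoc A A A) (mat_tensor (mat_dagger \<mu>) (mat_id A)))
      (a, b) (c, d)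
      = (\<Sum>(x, p)\<in>A \<times> (A \<times> A). if x = c then (case p of (y, z) \<Rightarrow>
           if z = b then \<mu> (x, y) a * \<mu> (y, z) d else 0) else 0)"
      unfolding mat_comp_def[where Y = "A \<times> (A \<times> A)"] using True
      by (intro sum.cong) (auto simp: inner mat_tensor_apply mat_id_apply)
    also have "\<dots> = (\<Sum>(y, z)\<in>A \<times> A. if z = b then \<mu> (c, y) a * \<mu> (y, z) d else 0)"
      using fin True by (subst sum_delta_left) auto
    also have "\<dots> = (\<Sum>y\<in>A. \<mu> (c, y) a * \<mu> (y, b) d)"
      using fin True by (subst sum_delta_right) auto
    finally show ?thesis .
  next
    case False
    have "mat_comp (A \<times> (A \<times> A)) (mat_tensor (mat_id A) \<mu>)
      (mat_comp ((A \<times> A) \<times> A) (mat_assoc A A A) (mat_tensor (mat_dagger \<mu>) (mat_id A)))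
      (a, b) (c, d) = 0"
      unfolding mat_comp_def[where Y = "A \<times> (A \<times> A)"] using False
      by (intro sum.neutral) (auto simp: inner mat_tensor_apply mat_id_apply)
    then show ?thesis using False by (auto simp: zero)
  qed
qed

lemma dagger_frobeniusI:
  assumes mon: "mat_monoid A \<mu> e"
    and left: "\<And>a b c d. a \<in> A \<Longrightarrow> b \<in> A \<Longrightarrow> c \<in> A \<Longrightarrow> d \<in> A \<Longrightarrow>
      (\<Sum>x\<in>A. \<mu> (x, d) b * \<mu> (a, x) c) = (\<Sum>x\<in>A. \<mu> (a, b) x * \<mu> (c, d) x)"
    and right: "\<And>a b c d. a \<in> A \<Longrightarrow> b \<in> A \<Longrightarrow> c \<in> A \<Longrightarrow> d \<in> A \<Longrightarrow>
      (\<Sum>x\<in>A. \<mu> (c, x) a * \<mu> (x, b) d) = (\<Sum>x\<in>A. \<mu> (a, b) x * \<mu> (c, d) x)"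
  shows "dagger_frobenius A \<mu> e"
proof -
  have fin: "finite A" and hom: "\<mu> \<in> mat_hom (A \<times> A) A"
    using mon by (auto simp: mat_monoid_def)
  have zero: "\<mu> (x, y) z = 0" if "x \<notin> A \<or> y \<notin> A \<or> z \<notin> A" for x y z
    using mat_hom_zero[OF hom, of "(x, y)" z] that by auto
  have mid: "mat_comp A (mat_dagger \<mu>) \<mu> (a, b) (c, d) = (\<Sum>x\<in>A. \<mu> (a, b) x * \<mu> (c, d) x)"
    for a b c d by (simp add: mat_comp_def mat_dagger_def)
  have left': "(\<Sum>x\<in>A. \<mu> (x, d) b * \<mu> (a, x) c) = (\<Sum>x\<in>A. \<mu> (a, b) x * \<mu> (c, d) x)" for a b c d
    by (cases "a \<in> A \<and> b \<in> A \<and> c \<in> A \<and> d \<in> A") (auto simp: left zero)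
  have right': "(\<Sum>x\<in>A. \<mu> (c, x) a * \<mu> (x, b) d) = (\<Sum>x\<in>A. \<mu> (a, b) x * \<mu> (c, d) x)" for a b c d
    by (cases "a \<in> A \<and> b \<in> A \<and> c \<in> A \<and> d \<in> A") (auto simp: right zero)
  show ?thesis
    unfolding dagger_frobenius_def
    by (intro conjI mon ext; clarify)
      (simp_all only: frobenius_left_apply[OF fin hom] frobenius_right_apply[OF fin hom] mid left' right')
qed

text \<open>The algebraic core, separated from all counting: \<open>star\<close> stands for the
  converse of a class, and \<open>r\<close> and \<open>s\<close> are the weights paid for exchanging
  the result of a product with its first or second factor, respectively. Each half of the Frobenius
  law uses such an exchange at an element and at its \<open>star\<close>, so the weights need only
  be inverse to each other there.\<close>

lemma dagger_frobenius_involutionI: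
  assumes mon: "mat_monoid A \<mu> e"
    and assoc: "\<And>a b c d. a \<in> A \<Longrightarrow> b \<in> A \<Longrightarrow> c \<in> A \<Longrightarrow> d \<in> A \<Longrightarrow>
      (\<Sum>x\<in>A. \<mu> (a, b) x * \<mu> (x, c) d) = (\<Sum>x\<in>A. \<mu> (b, c) x * \<mu> (a, x) d)"
    and star: "\<And>a. a \<in> A \<Longrightarrow> star a \<in> A" "\<And>a. a \<in> A \<Longrightarrow> star (star a) = a"
    and r: "\<And>a. a \<in> A \<Longrightarrow> r a * r (star a) = 1"
    and s: "\<And>a. a \<in> A \<Longrightarrow> s a * s (star a) = 1"
    and right_move: "\<And>a b c. a \<in> A \<Longrightarrow> b \<in> A \<Longrightarrow> c \<in> A \<Longrightarrow> \<mu> (a, b) c = r b * \<mu> (c, star b) a"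
    and left_move: "\<And>a b c. a \<in> A \<Longrightarrow> b \<in> A \<Longrightarrow> c \<in> A \<Longrightarrow> \<mu> (a, b) c = s a * \<mu> (star a, c) b"
  shows "dagger_frobenius A \<mu> e"
proof (rule dagger_frobeniusI[OF mon])
  fix a b c d assume A: "a \<in> A" "b \<in> A" "c \<in> A" "d \<in> A"
  \<comment> \<open>Exchanging \<open>x\<close> and \<open>b\<close> along \<open>d\<close> makes
    \<open>x\<close> the input of one factor and the result of the other, which is the shape of
    associativity. After rebracketing, an exchange along \<open>star d\<close> turns
    \<open>x\<close> back into a result and restores \<open>d\<close>.\<close>
  have "(\<Sum>x\<in>A. \<mu> (x, d) b * \<mu> (a, x) c) = r d * (\<Sum>x\<in>A. \<mu> (b, star d) x * \<mu> (a, x) c)"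
    unfolding sum_distrib_left using A by (intro sum.cong refl) (simp add: right_move[of _ d b])
  also have "\<dots> = r d * (\<Sum>x\<in>A. \<mu> (a, b) x * \<mu> (x, star d) c)"
    using A star by (simp add: assoc)
  also have "\<dots> = (\<Sum>x\<in>A. (r d * r (star d)) * (\<mu> (a, b) x * \<mu> (c, d) x))"
    unfolding sum_distrib_left using A star
    by (intro sum.cong refl) (simp add: right_move[of _ "star d" c])
  finally show "(\<Sum>x\<in>A. \<mu> (x, d) b * \<mu> (a, x) c) = (\<Sum>x\<in>A. \<mu> (a, b) x * \<mu> (c, d) x)"
    using A r by simp
  \<comment> \<open>The same argument from the other side, with exchanges along \<open>c\<close> and
    \<open>star c\<close>.\<close>
  have "(\<Sum>x\<in>A. \<mu> (c, x) a * \<mu> (x, b) d) = s c * (\<Sum>x\<in>A. \<mu> (star c, a) x * \<mu> (x, b) d)"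
    unfolding sum_distrib_left using A by (intro sum.cong refl) (simp add: left_move[of c _ a])
  also have "\<dots> = s c * (\<Sum>x\<in>A. \<mu> (a, b) x * \<mu> (star c, x) d)"
    using A star by (simp add: assoc)
  also have "\<dots> = (\<Sum>x\<in>A. (s c * s (star c)) * (\<mu> (a, b) x * \<mu> (c, d) x))"
    unfolding sum_distrib_left using A star
    by (intro sum.cong refl) (simp add: left_move[of "star c" _ d])
  finally show "(\<Sum>x\<in>A. \<mu> (c, x) a * \<mu> (x, b) d) = (\<Sum>x\<in>A. \<mu> (a, b) x * \<mu> (c, d) x)"
    using A s by simp
qed

section \<open>Classes and valencies of a coherent configuration\<close>

locale coherent_config =
  fixes X :: "'a set" and S :: "('a \<times> 'a) set set"
  assumes coherent: "coherent_configuration X S"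
begin

abbreviation N where "N a b c \<equiv> intersection_number X a b c"
abbreviation v where "v a \<equiv> valency X a"

lemma finite_X: "finite X"
  and partition: "partition_on (X \<times> X) S"
  and converse_in: "a \<in> S \<Longrightarrow> a\<inverse> \<in> S"
  using coherent by (auto simp: coherent_configuration_def)

lemma diagonal_class: "a \<in> S \<Longrightarrow> (x, x) \<in> a \<Longrightarrow> a \<subseteq> Id_on X"
  using coherent by (auto simp: coherent_configuration_def)

lemma finite_S: "finite S"
  using finite_elements[OF _ partition] finite_X by simp

lemma class_subset: "a \<in> S \<Longrightarrow> a \<subseteq> X \<times> X"
  using partition by (auto simp: partition_on_def)

lemma class_unique: "a \<in> S \<Longrightarrow> b \<in> S \<Longrightarrow> p \<in> a \<Longrightarrow> p \<in> b \<Longrightarrow> a = b"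
  using partition by (auto simp: partition_on_def disjoint_def)

lemma class_ex: "x \<in> X \<Longrightarrow> y \<in> X \<Longrightarrow> \<exists>a\<in>S. (x, y) \<in> a"
  using partition by (auto simp: partition_on_def)

lemma class_nonempty:
  assumes "a \<in> S" obtains x y where "(x, y) \<in> a"
  using assms partition by (metis all_not_in_conv partition_on_def surj_pair)

lemma N_eq:
  "a \<in> S \<Longrightarrow> b \<in> S \<Longrightarrow> c \<in> S \<Longrightarrow> (x, y) \<in> c \<Longrightarrow> N a b c = card {z \<in> X. (x, z) \<in> a \<and> (z, y) \<in> b}"
  by (rule intersection_number_eq[OF coherent])

lemma v_eq: "a \<in> S \<Longrightarrow> (x, y) \<in> a \<Longrightarrow> v a = card {y \<in> X. (x, y) \<in> a}"
  by (rule valency_eq[OF coherent])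

lemma v_pos: assumes "a \<in> S" shows "0 < v a"
proof -
  obtain x y where xy: "(x, y) \<in> a" using class_nonempty[OF assms] .
  then have "y \<in> {y \<in> X. (x, y) \<in> a}" using class_subset[OF assms] by auto
  then show ?thesis using v_eq[OF assms xy] finite_X by (auto simp: card_gt_0_iff)
qed

section \<open>Counting identities for intersection numbers\<close>

lemma N_nonzeroD:
  assumes "a \<in> S" "b \<in> S" "c \<in> S" "N a b c \<noteq> 0"
  obtains x y z where "(x, y) \<in> c" "(x, z) \<in> a" "(z, y) \<in> b"
proof -
  obtain x y where xy: "(x, y) \<in> c" using class_nonempty[OF assms(3)] .
  then have "{z \<in> X. (x, z) \<in> a \<and> (z, y) \<in> b} \<noteq> {}"
    using N_eq[OF assms(1-3) xy] assms(4) by force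
  then show ?thesis using that xy by blast
qed

text \<open>A path from \<open>x\<close> through \<open>z\<close> to \<open>y\<close> read backwards
  has the same midpoint, so the two numbers count the same set.\<close>

lemma N_converse:
  assumes "a \<in> S" "b \<in> S" "c \<in> S"
  shows "N (b\<inverse>) (a\<inverse>) (c\<inverse>) = N a b c"
proof -
  obtain x y where xy: "(x, y) \<in> c" using class_nonempty[OF assms(3)] .
  then have yx: "(y, x) \<in> c\<inverse>" by simp
  show ?thesis
    using N_eq[OF assms xy] N_eq[OF converse_in converse_in converse_in yx] assms
    by (simp add: conj_commute)
qed

text \<open>The pairs are fibred over their first component: each endpoint of a
  \<open>c\<close>-edge at \<open>x\<close> has \<open>N a b c\<close> midpoints above it. The
  variable \<open>y\<close> bound in the set differs from the fixed \<open>y\<close>, whose edge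
  makes \<open>v c\<close> the number of \<open>c\<close>-edges leaving \<open>x\<close>.\<close>

lemma sum_fibres:
  assumes "a \<in> S" "b \<in> S" "c \<in> S" "(x, y) \<in> c"
  shows "card {(y, z) \<in> X \<times> X. (x, y) \<in> c \<and> (x, z) \<in> a \<and> (z, y) \<in> b} = v c * N a b c"
proof -
  have "{(y, z) \<in> X \<times> X. (x, y) \<in> c \<and> (x, z) \<in> a \<and> (z, y) \<in> b}
      = Sigma {y \<in> X. (x, y) \<in> c} (\<lambda>y. {z \<in> X. (x, z) \<in> a \<and> (z, y) \<in> b})"
    by auto
  also have "card \<dots> = card {y \<in> X. (x, y) \<in> c} * N a b c"
    using finite_X N_eq[OF assms(1-3)] by (intro card_Sigma_const) auto
  also have "\<dots> = v c * N a b c"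
    using v_eq[OF assms(3,4)] by simp
  finally show ?thesis .
qed

text \<open>With the vertex \<open>x\<close> fixed, the triangles are fibred over the end of the
  \<open>c\<close>-edge on one side and over the end of the \<open>a\<close>-edge on the
  other.\<close>

lemma triangle_count:
  assumes S: "a \<in> S" "b \<in> S" "c \<in> S"
  shows "v c * N a b c = v a * N c (b\<inverse>) a"
proof -
  \<comment> \<open>Both fibrations must start at the same \<open>x\<close>, so \<open>x\<close> has
    to have an outgoing edge in \<open>c\<close> and in \<open>a\<close>. A nonzero intersection
    number on either side supplies a triangle with both edges; if both numbers are zero, the
    equation is trivial.\<close>
  have common: "v c * N a b c = v a * N c (b\<inverse>) a" if xy: "(x, y) \<in> c" and xz: "(x, z) \<in> a" for x y z
  proof -
    have "bij_betw prod.swap {(y, z) \<in> X \<times> X. (x, y) \<in> c \<and> (x, z) \<in> a \<and> (z, y) \<in> b}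
        {(z, y) \<in> X \<times> X. (x, z) \<in> a \<and> (x, y) \<in> c \<and> (y, z) \<in> b\<inverse>}"
      by (rule bij_betw_byWitness[where f' = prod.swap]) auto
    then show ?thesis
      using sum_fibres[OF S xy] sum_fibres[OF S(3) converse_in[OF S(2)] S(1) xz]
      by (simp add: bij_betw_same_card)
  qed
  show ?thesis
  proof (cases "N a b c = 0 \<and> N c (b\<inverse>) a = 0")
    case False
    then show ?thesis
      using N_nonzeroD[OF S] N_nonzeroD[OF S(3) converse_in[OF S(2)] S(1)] common by metis
  qed simp
qed

text \<open>The counterpart for the first index: moving the second index, reversing all paths, and
  moving the second index again. Valencies count outgoing edges, which is why those of
  \<open>a\<close> and of its converse both remain.\<close>

lemma triangle_count':
  assumes S: "a \<in> S" "b \<in> S" "c \<in> S"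
  shows "v a * v b * N (a\<inverse>) c b = v (a\<inverse>) * v c * N a b c"
proof -
  have "v b * N (a\<inverse>) c b = v (a\<inverse>) * N b (c\<inverse>) (a\<inverse>)"
    using S converse_in by (intro triangle_count) auto
  also have "N b (c\<inverse>) (a\<inverse>) = N c (b\<inverse>) a"
    using N_converse[of c "b\<inverse>" a] S converse_in by simp
  finally show ?thesis
    using triangle_count[OF S] by (simp add: mult.assoc)
qed

lemma N_assoc:
  assumes S: "a \<in> S" "b \<in> S" "c \<in> S" "d \<in> S"
  shows "(\<Sum>s\<in>S. N a b s * N s c d) = (\<Sum>s\<in>S. N b c s * N a s d)"
proof -
  obtain x y where xy: "(x, y) \<in> d" using class_nonempty[OF S(4)] .
  define T where "T = {(z, w) \<in> X \<times> X. (x, z) \<in> a \<and> (z, w) \<in> b \<and> (w, y) \<in> c}"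
  have xyX: "x \<in> X" "y \<in> X" using class_subset[OF S(4)] xy by auto
  have disj: "s = s'" if "s \<in> S" "s' \<in> S" "p \<in> s" "p \<in> s'" for s s' p
    using class_unique that by blast
  \<comment> \<open>Chains are sorted by the class \<open>s\<close> of the shortcut from
    \<open>x\<close> to \<open>w\<close>. The fibration lists \<open>w\<close> before
    \<open>z\<close>, hence the converse, which leaves the cardinality unchanged.\<close>
  have "T = (\<Union>s\<in>S. Sigma {w \<in> X. (x, w) \<in> s \<and> (w, y) \<in> c} (\<lambda>w. {z \<in> X. (x, z) \<in> a \<and> (z, w) \<in> b}))\<inverse>"
    using class_ex[OF xyX(1)] unfolding T_def by fastforce
  then have "card T = card (\<Union>s\<in>S. Sigma {w \<in> X. (x, w) \<in> s \<and> (w, y) \<in> c}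
      (\<lambda>w. {z \<in> X. (x, z) \<in> a \<and> (z, w) \<in> b}))"
    by (simp only: card_inverse)
  also have "\<dots> = (\<Sum>s\<in>S. card (Sigma {w \<in> X. (x, w) \<in> s \<and> (w, y) \<in> c}
      (\<lambda>w. {z \<in> X. (x, z) \<in> a \<and> (z, w) \<in> b})))"
    using finite_S finite_X by (subst card_UN_disjoint) (auto dest: disj)
  also have "\<dots> = (\<Sum>s\<in>S. N a b s * N s c d)"
  proof (rule sum.cong[OF refl])
    fix s assume s: "s \<in> S"
    have "card (Sigma {w \<in> X. (x, w) \<in> s \<and> (w, y) \<in> c} (\<lambda>w. {z \<in> X. (x, z) \<in> a \<and> (z, w) \<in> b}))
        = card {w \<in> X. (x, w) \<in> s \<and> (w, y) \<in> c} * N a b s"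
      using finite_X N_eq[OF S(1,2) s] by (intro card_Sigma_const) auto
    then show "card (Sigma {w \<in> X. (x, w) \<in> s \<and> (w, y) \<in> c} (\<lambda>w. {z \<in> X. (x, z) \<in> a \<and> (z, w) \<in> b}))
        = N a b s * N s c d"
      using N_eq[OF s S(3,4) xy] by simp
  qed
  finally have 1: "card T = (\<Sum>s\<in>S. N a b s * N s c d)" .
  \<comment> \<open>The second count sorts the same chains by the class of the shortcut from
    \<open>z\<close> to \<open>y\<close>.\<close>
  have "T = (\<Union>s\<in>S. Sigma {z \<in> X. (x, z) \<in> a \<and> (z, y) \<in> s} (\<lambda>z. {w \<in> X. (z, w) \<in> b \<and> (w, y) \<in> c}))"
    using class_ex[OF _ xyX(2)] unfolding T_def by fastforce
  then have "card T = (\<Sum>s\<in>S. card (Sigma {z \<in> X. (x, z) \<in> a \<and> (z, y) \<in> s}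
      (\<lambda>z. {w \<in> X. (z, w) \<in> b \<and> (w, y) \<in> c})))"
    using finite_S finite_X by (simp only:) (subst card_UN_disjoint; auto dest: disj)
  also have "\<dots> = (\<Sum>s\<in>S. N b c s * N a s d)"
  proof (rule sum.cong[OF refl])
    fix s assume s: "s \<in> S"
    have "card (Sigma {z \<in> X. (x, z) \<in> a \<and> (z, y) \<in> s} (\<lambda>z. {w \<in> X. (z, w) \<in> b \<and> (w, y) \<in> c}))
        = card {z \<in> X. (x, z) \<in> a \<and> (z, y) \<in> s} * N b c s"
      using finite_X N_eq[OF S(2,3) s] by (intro card_Sigma_const) auto
    then show "card (Sigma {z \<in> X. (x, z) \<in> a \<and> (z, y) \<in> s} (\<lambda>z. {w \<in> X. (z, w) \<in> b \<and> (w, y) \<in> c}))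
        = N b c s * N a s d"
      using N_eq[OF S(1) s S(4) xy] by simp
  qed
  finally show ?thesis using 1 by simp
qed

section \<open>Diagonal classes as units\<close>

lemma v_identity:
  assumes "a \<in> S" "a \<subseteq> Id_on X" shows "v a = 1"
proof -
  obtain x y where xy: "(x, y) \<in> a" using class_nonempty[OF assms(1)] .
  then have "{y \<in> X. (x, y) \<in> a} = {x}" using assms(2) by auto
  then show ?thesis using v_eq[OF assms(1) xy] by simp
qed

text \<open>For an edge \<open>(x, y)\<close> of \<open>c\<close>, the class \<open>i\<close> is the
  one containing \<open>(x, x)\<close>. A diagonal first step forces the midpoint
  \<open>z = x\<close>, so \<open>a\<close> must be \<open>i\<close> and \<open>b\<close> must
  contain \<open>(x, y)\<close>. There may be several diagonal classes, but exactly one of them acts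
  on \<open>c\<close> from the left.\<close>

lemma identity_N_left:
  assumes S: "b \<in> S" "c \<in> S"
  obtains i where "i \<in> S" "i \<subseteq> Id_on X"
    "\<And>a. a \<in> S \<Longrightarrow> a \<subseteq> Id_on X \<Longrightarrow> N a b c = (if a = i \<and> b = c then 1 else 0)"
proof -
  obtain x y where xy: "(x, y) \<in> c" using class_nonempty[OF S(2)] .
  have x: "x \<in> X" using class_subset[OF S(2)] xy by auto
  obtain i where i: "i \<in> S" "(x, x) \<in> i" using class_ex[OF x x] by blast
  have "N a b c = (if a = i \<and> b = c then 1 else 0)" if a: "a \<in> S" "a \<subseteq> Id_on X" for a
  proof -
    have "{z \<in> X. (x, z) \<in> a \<and> (z, y) \<in> b} = (if a = i \<and> b = c then {x} else {})"
      using a i x xy S class_unique by (fastforce split: if_splits)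
    then show ?thesis using N_eq[OF a(1) S xy] by auto
  qed
  then show ?thesis using that[OF i(1) diagonal_class[OF i]] by blast
qed

text \<open>Follows from the left version by reversing paths, since a diagonal class is its own
  converse.\<close>

lemma identity_N_right:
  assumes S: "b \<in> S" "c \<in> S"
  obtains i where "i \<in> S" "i \<subseteq> Id_on X"
    "\<And>a. a \<in> S \<Longrightarrow> a \<subseteq> Id_on X \<Longrightarrow> N b a c = (if a = i \<and> b = c then 1 else 0)"
proof -
  obtain i where i: "i \<in> S" "i \<subseteq> Id_on X"
    "\<And>a. a \<in> S \<Longrightarrow> a \<subseteq> Id_on X \<Longrightarrow> N a (b\<inverse>) (c\<inverse>) = (if a = i \<and> b\<inverse> = c\<inverse> then 1 else 0)"
    using identity_N_left[OF converse_in converse_in] S by metis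
  have "N b a c = (if a = i \<and> b = c then 1 else 0)" if a: "a \<in> S" "a \<subseteq> Id_on X" for a
  proof -
    have "a\<inverse> = a" using a(2) by fastforce
    then show ?thesis using N_converse[OF S(1) a(1) S(2)] i(3)[OF a] by simp
  qed
  with i that show ?thesis by blast
qed

section \<open>The normalized multiplication\<close>

abbreviation \<mu> where "\<mu> \<equiv> normalized_mult X S"

lemma mult_apply:
  "a \<in> S \<Longrightarrow> b \<in> S \<Longrightarrow> c \<in> S \<Longrightarrow> \<mu> (a, b) c = sqrt (v c / (v a * v b)) * N a b c"
  by (simp add: normalized_mult_def mat_on_def)

lemma mult_assoc:
  assumes S: "a \<in> S" "b \<in> S" "c \<in> S" "d \<in> S"
  shows "(\<Sum>s\<in>S. \<mu> (a, b) s * \<mu> (s, c) d) = (\<Sum>s\<in>S. \<mu> (b, c) s * \<mu> (a, s) d)"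
proof -
  \<comment> \<open>This is what remains of the two normalizing factors once \<open>v s\<close>
    cancels. It is symmetric in \<open>a\<close>, \<open>b\<close> and \<open>c\<close>, hence
    common to both bracketings.\<close>
  define k where "k = sqrt (v d / (v a * v b * v c))"
  have "\<mu> (a, b) s * \<mu> (s, c) d = k * real (N a b s * N s c d)"
    "\<mu> (b, c) s * \<mu> (a, s) d = k * real (N b c s * N a s d)" if s: "s \<in> S" for s
    using S s v_pos[OF s] unfolding k_def
    by (simp_all add: mult_apply real_sqrt_mult real_sqrt_divide mult_ac)
  then have "(\<Sum>s\<in>S. \<mu> (a, b) s * \<mu> (s, c) d) = k * real (\<Sum>s\<in>S. N a b s * N s c d)"
    "(\<Sum>s\<in>S. \<mu> (b, c) s * \<mu> (a, s) d) = k * real (\<Sum>s\<in>S. N b c s * N a s d)"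
    by (simp_all add: sum_distrib_left)
  then show ?thesis using N_assoc[OF S] by simp
qed

lemma mult_unit:
  assumes S: "a \<in> S" "b \<in> S"
  shows "(\<Sum>s\<in>S. identity_unit X S () s * \<mu> (s, a) b) = (if a = b then 1 else 0)"
    and "(\<Sum>s\<in>S. identity_unit X S () s * \<mu> (a, s) b) = (if a = b then 1 else 0)"
proof -
  obtain i where i: "i \<in> S" "i \<subseteq> Id_on X"
    "\<And>s. s \<in> S \<Longrightarrow> s \<subseteq> Id_on X \<Longrightarrow> N s a b = (if s = i \<and> a = b then 1 else 0)"
    using identity_N_left[OF S] by metis
  \<comment> \<open>At \<open>s = i\<close> and \<open>a = b\<close> the normalizing factor is 1
    because \<open>v i = 1\<close>; every other summand vanishes.\<close>
  have "(\<Sum>s\<in>S. identity_unit X S () s * \<mu> (s, a) b) = (\<Sum>s\<in>S. if s = i then (if a = b then 1 else 0) else 0)"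
    using S i v_pos[OF S(1)]
    by (intro sum.cong refl; rename_tac s, case_tac "s \<subseteq> Id_on X"; case_tac "s = i"; cases "a = b")
      (simp_all add: identity_unit_def mat_on_def mult_apply v_identity)
  then show "(\<Sum>s\<in>S. identity_unit X S () s * \<mu> (s, a) b) = (if a = b then 1 else 0)"
    using i(1) finite_S by simp
next
  obtain i where i: "i \<in> S" "i \<subseteq> Id_on X"
    "\<And>s. s \<in> S \<Longrightarrow> s \<subseteq> Id_on X \<Longrightarrow> N a s b = (if s = i \<and> a = b then 1 else 0)"
    using identity_N_right[OF S] by metis
  have "(\<Sum>s\<in>S. identity_unit X S () s * \<mu> (a, s) b) = (\<Sum>s\<in>S. if s = i then (if a = b then 1 else 0) else 0)"
    using S i v_pos[OF S(1)]
    by (intro sum.cong refl; rename_tac s, case_tac "s \<subseteq> Id_on X"; case_tac "s = i"; cases "a = b")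
      (simp_all add: identity_unit_def mat_on_def mult_apply v_identity)
  then show "(\<Sum>s\<in>S. identity_unit X S () s * \<mu> (a, s) b) = (if a = b then 1 else 0)"
    using i(1) finite_S by simp
qed

lemma mult_move_right:
  assumes S: "a \<in> S" "b \<in> S" "c \<in> S"
  shows "\<mu> (a, b) c = sqrt (v (b\<inverse>) / v b) * \<mu> (c, b\<inverse>) a"
proof -
  \<comment> \<open>Naming the square roots turns the claim into an identity of fractions. The root
    \<open>B'\<close> cancels on the right, leaving the triangle count divided by
    \<open>A * B * C\<close>.\<close>
  define A B C B' where "A = sqrt (v a)" and "B = sqrt (v b)" and "C = sqrt (v c)" and "B' = sqrt (v (b\<inverse>))"
  have pos: "A > 0" "B > 0" "C > 0" "B' > 0"
    using S v_pos converse_in by (auto simp: A_def B_def C_def B'_def)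
  have "real (v c * N a b c) = real (v a * N c (b\<inverse>) a)" using triangle_count[OF S] by simp
  moreover have "real (v c) = C * C" "real (v a) = A * A" by (simp_all add: A_def C_def)
  ultimately have "C * C * N a b c = A * A * N c (b\<inverse>) a" by simp
  then have "C / (A * B) * N a b c = B' / B * (A / (C * B') * N c (b\<inverse>) a)"
    using pos by (simp add: field_simps)
  then show ?thesis
    using S converse_in
    by (simp add: mult_apply real_sqrt_mult real_sqrt_divide A_def B_def C_def B'_def)
qed

text \<open>The normalized form of \<open>triangle_count'\<close>. The weight has \<open>v a\<close>
  in the numerator, whereas the right move has the valency of the converse there.\<close>

lemma mult_move_left:
  assumes S: "a \<in> S" "b \<in> S" "c \<in> S"
  shows "\<mu> (a, b) c = sqrt (v a / v (a\<inverse>)) * \<mu> (a\<inverse>, c) b"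
proof -
  define A B C A' where "A = sqrt (v a)" and "B = sqrt (v b)" and "C = sqrt (v c)" and "A' = sqrt (v (a\<inverse>))"
  have pos: "A > 0" "B > 0" "C > 0" "A' > 0"
    using S v_pos converse_in by (auto simp: A_def B_def C_def A'_def)
  have "real (v a * v b * N (a\<inverse>) c b) = real (v (a\<inverse>) * v c * N a b c)"
    using triangle_count'[OF S] by simp
  moreover have "real (v c) = C * C" "real (v a) = A * A" "real (v b) = B * B" "real (v (a\<inverse>)) = A' * A'"
    by (simp_all add: A_def B_def C_def A'_def)
  ultimately have "A * A * (B * B) * N (a\<inverse>) c b = A' * A' * (C * C) * N a b c" by simp
  then have "C / (A * B) * N a b c = A / A' * (B / (A' * C) * N (a\<inverse>) c b)"
    using pos by (simp add: field_simps)
  then show ?thesis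
    using S converse_in
    by (simp add: mult_apply real_sqrt_mult real_sqrt_divide A_def B_def C_def A'_def)
qed

lemma mult_monoid: "mat_monoid S \<mu> (identity_unit X S)"
proof (rule mat_monoidI)
  show "\<mu> \<in> mat_hom (S \<times> S) S" "identity_unit X S \<in> mat_hom {()} S"
    by (auto simp: mat_hom_def normalized_mult_def identity_unit_def mat_on_def)
qed (fact finite_S mult_assoc mult_unit)+

lemma mult_dagger_frobenius: "dagger_frobenius S \<mu> (identity_unit X S)"
\<comment> \<open>Taking the converse swaps numerator and denominator in both weights, so each is
  inverse to its value at the converse class; positive valencies make the quotients cancel.\<close>
proof (rule dagger_frobenius_involutionI[where star = converse
      and r = "\<lambda>b. sqrt (real (v (b\<inverse>)) / real (v b))" and s = "\<lambda>a. sqrt (real (v a) / real (v (a\<inverse>)))"])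
  fix a assume a: "a \<in> S"
  show "sqrt (v (a\<inverse>) / v a) * sqrt (v ((a\<inverse>)\<inverse>) / v (a\<inverse>)) = 1"
    "sqrt (v a / v (a\<inverse>)) * sqrt (v (a\<inverse>) / v ((a\<inverse>)\<inverse>)) = 1"
    using v_pos[OF a] v_pos[OF converse_in[OF a]] by (simp_all add: real_sqrt_divide)
qed (rule mult_monoid mult_assoc converse_in converse_converse mult_move_right mult_move_left; assumption)+

end

theorem theorem6p3:
  fixes X :: "'a set" and S :: "('a \<times> 'a) set set"
  assumes "coherent_configuration X S"
  shows "dagger_frobenius S (normalized_mult X S) (identity_unit X S)"
proof -
  interpret coherent_config X S by unfold_locales (rule assms)
  show ?thesis by (rule mult_dagger_frobenius)
qed

end
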